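(* Let $(M,F)$ be a Finsler manifold and $\gamma:(-a,a)\to M$ a differentiable curve with $\gamma(0)=p$ and $\gamma'(0)=v$. Then $$\lim_{t\to0}\frac{d_F(\gamma(t),p)}{|t|}=F(v).$$
   Context: Manifolds are Hausdorff with countable basis. A Finsler metric ($C^0$-Finsler) on a differentiable manifold $M$ is a continuous function $F:TM\to\mathbb R$ whose restriction $F(p,\cdot)$ to each tangent space $T_pM$ is a norm (no smoothness or strong convexity is required); $F(v)$ abbreviates $F(p,v)$ for $v\in T_pM$. The distance function of $F$ is $d_F(x,y)=\inf_\gamma\int F(\gamma'(t))\,dt$, the infimum being over piecewise continuously differentiable paths connecting $x$ and $y$. *)

theory Defs
  imports "HOL-Analysis.Analysis" "HOL-Library.Extended_Nat"
begin

section \<open>Differentiability classes on open subsets of Euclidean space\<close>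

text \<open>To be used with open \<open>S\<close> only. For \<open>Suc n\<close> it says that \<open>f\<close> is differentiable and that all
  its directional derivatives are of class \<open>n\<close>; in finite dimension this is the usual notion.\<close>

fun Cn_on :: "nat \<Rightarrow> ('e::euclidean_space \<Rightarrow> 'e) \<Rightarrow> 'e set \<Rightarrow> bool" where
  "Cn_on 0 f S \<longleftrightarrow> continuous_on S f"
| "Cn_on (Suc n) f S \<longleftrightarrow> (\<forall>x\<in>S. f differentiable (at x)) \<and>
     (\<forall>w. Cn_on n (\<lambda>x. frechet_derivative f (at x) w) S)"

definition class_on :: "enat \<Rightarrow> ('e::euclidean_space \<Rightarrow> 'e) \<Rightarrow> 'e set \<Rightarrow> bool" where
  "class_on k f S \<longleftrightarrow> (\<forall>n::nat. enat n \<le> k \<longrightarrow> Cn_on n f S)"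

section \<open>Differentiable manifolds\<close>

text \<open>A chart is a domain together with its coordinate map; the values of the coordinate map
  outside the domain are irrelevant.\<close>

type_synonym ('a, 'e) chart = "'a set \<times> ('a \<Rightarrow> 'e)"

definition transition :: "('a, 'e) chart \<Rightarrow> ('a, 'e) chart \<Rightarrow> 'e \<Rightarrow> 'e" where
  "transition c d = snd d \<circ> inv_into (fst c) (snd c)"

definition differentiable_manifold ::
    "enat \<Rightarrow> 'a topology \<Rightarrow> ('a, 'e::euclidean_space) chart set \<Rightarrow> bool" where
  "differentiable_manifold k X A \<longleftrightarrow>
     1 \<le> k \<and> Hausdorff_space X \<and> second_countable X \<and>
     (\<Union>c\<in>A. fst c) = topspace X \<and>
     (\<forall>c\<in>A. openin X (fst c) \<and> open (snd c ` fst c) \<and>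
        homeomorphic_map (subtopology X (fst c)) (top_of_set (snd c ` fst c)) (snd c)) \<and>
     (\<forall>c\<in>A. \<forall>d\<in>A. class_on k (transition c d) (snd c ` (fst c \<inter> fst d)))"

section \<open>The tangent bundle\<close>

text \<open>A tangent vector at \<open>p\<close> is the family of its components with respect to all charts around
  \<open>p\<close>, these components being related by the derivatives of the transition maps. Components for
  all other arguments are set to 0, so that equality of tangent vectors is equality of functions and
  the vector space operations are the pointwise ones.\<close>

type_synonym ('a, 'e) tangent_vector = "('a, 'e) chart \<Rightarrow> 'e"

definition tangent_space ::
    "('a, 'e::euclidean_space) chart set \<Rightarrow> 'a \<Rightarrow> ('a, 'e) tangent_vector set" where
  "tangent_space A p = {v.
     (\<forall>c. \<not> (c \<in> A \<and> p \<in> fst c) \<longrightarrow> v c = 0) \<and>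
     (\<forall>c\<in>A. \<forall>d\<in>A. p \<in> fst c \<inter> fst d \<longrightarrow>
        v d = frechet_derivative (transition c d) (at (snd c p)) (v c))}"

definition tangent_bundle ::
    "'a topology \<Rightarrow> ('a, 'e::euclidean_space) chart set \<Rightarrow> ('a \<times> ('a, 'e) tangent_vector) set" where
  "tangent_bundle X A = (SIGMA p:topspace X. tangent_space A p)"

text \<open>The topology for which the bundle charts \<open>(p, v) \<mapsto> (snd c p, v c)\<close> are homeomorphisms onto
  open sets: it is generated by the preimages of open sets under them.\<close>

definition tangent_bundle_topology ::
    "'a topology \<Rightarrow> ('a, 'e::euclidean_space) chart set \<Rightarrow> ('a \<times> ('a, 'e) tangent_vector) topology"
  where
  "tangent_bundle_topology X A = topology_generated_by
     {{(p, v) \<in> tangent_bundle X A. p \<in> fst c \<and> (snd c p, v c) \<in> W} | c W.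
        c \<in> A \<and> open (W :: ('e \<times> 'e) set)}"

section \<open>Curves\<close>

text \<open>At endpoints belonging to the interval \<open>I\<close>, differentiability and derivatives are one-sided.\<close>

definition differentiable_curve_on ::
    "'a topology \<Rightarrow> ('a, 'e::euclidean_space) chart set \<Rightarrow> real set \<Rightarrow> (real \<Rightarrow> 'a) \<Rightarrow> bool" where
  "differentiable_curve_on X A I \<gamma> \<longleftrightarrow>
     continuous_map (top_of_set I) X \<gamma> \<and>
     (\<forall>c\<in>A. \<forall>t\<in>I. \<gamma> t \<in> fst c \<longrightarrow> (snd c \<circ> \<gamma>) differentiable (at t within I))"

definition velocity ::
    "('a, 'e::euclidean_space) chart set \<Rightarrow> real set \<Rightarrow> (real \<Rightarrow> 'a) \<Rightarrow> real \<Rightarrow>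
     ('a, 'e) tangent_vector" where
  "velocity A I \<gamma> t =
     (\<lambda>c. if c \<in> A \<and> \<gamma> t \<in> fst c then vector_derivative (snd c \<circ> \<gamma>) (at t within I) else 0)"

definition C1_curve_on ::
    "'a topology \<Rightarrow> ('a, 'e::euclidean_space) chart set \<Rightarrow> real set \<Rightarrow> (real \<Rightarrow> 'a) \<Rightarrow> bool" where
  "C1_curve_on X A I \<gamma> \<longleftrightarrow>
     differentiable_curve_on X A I \<gamma> \<and>
     (\<forall>c\<in>A. continuous_on {t \<in> I. \<gamma> t \<in> fst c} (\<lambda>t. velocity A I \<gamma> t c))"

definition piecewise_C1_path ::
    "'a topology \<Rightarrow> ('a, 'e::euclidean_space) chart set \<Rightarrow> real \<Rightarrow> real \<Rightarrow> (real \<Rightarrow> 'a) \<Rightarrow> bool" where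
  "piecewise_C1_path X A a b \<gamma> \<longleftrightarrow>
     continuous_map (top_of_set {a..b}) X \<gamma> \<and>
     (\<exists>n::nat. \<exists>\<tau>::nat \<Rightarrow> real. \<tau> 0 = a \<and> \<tau> n = b \<and>
        (\<forall>i<n. \<tau> i < \<tau> (Suc i) \<and> C1_curve_on X A {\<tau> i..\<tau> (Suc i)} \<gamma>))"

section \<open>Finsler metrics\<close>

definition is_norm_on :: "('b \<Rightarrow> 'e::real_vector) set \<Rightarrow> (('b \<Rightarrow> 'e) \<Rightarrow> real) \<Rightarrow> bool" where
  "is_norm_on V N \<longleftrightarrow>
     (\<forall>v\<in>V. 0 \<le> N v \<and> (N v = 0 \<longleftrightarrow> v = (\<lambda>_. 0))) \<and>
     (\<forall>v\<in>V. \<forall>r::real. N (\<lambda>c. r *\<^sub>R v c) = \<bar>r\<bar> * N v) \<and>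
     (\<forall>v\<in>V. \<forall>w\<in>V. N (\<lambda>c. v c + w c) \<le> N v + N w)"

definition finsler_metric ::
    "'a topology \<Rightarrow> ('a, 'e::euclidean_space) chart set \<Rightarrow>
     ('a \<Rightarrow> ('a, 'e) tangent_vector \<Rightarrow> real) \<Rightarrow> bool" where
  "finsler_metric X A F \<longleftrightarrow>
     continuous_map (tangent_bundle_topology X A) euclideanreal (\<lambda>(p, v). F p v) \<and>
     (\<forall>p\<in>topspace X. is_norm_on (tangent_space A p) (F p))"

text \<open>At the finitely many break points of a piecewise \<open>C\<^sup>1\<close> path the integrand is arbitrary, which
  does not affect the integral.\<close>

definition finsler_length ::
    "('a, 'e::euclidean_space) chart set \<Rightarrow> ('a \<Rightarrow> ('a, 'e) tangent_vector \<Rightarrow> real) \<Rightarrow>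
     real \<Rightarrow> real \<Rightarrow> (real \<Rightarrow> 'a) \<Rightarrow> real" where
  "finsler_length A F a b \<gamma> = integral {a..b} (\<lambda>t. F (\<gamma> t) (velocity A {a..b} \<gamma> t))"

text \<open>Manifolds need not be connected; the distance between points that are not joined by any
  admissible path is \<open>\<infinity>\<close>, the infimum of the empty set.\<close>

definition finsler_dist ::
    "'a topology \<Rightarrow> ('a, 'e::euclidean_space) chart set \<Rightarrow>
     ('a \<Rightarrow> ('a, 'e) tangent_vector \<Rightarrow> real) \<Rightarrow> 'a \<Rightarrow> 'a \<Rightarrow> ereal" where
  "finsler_dist X A F x y =
     Inf {ereal (finsler_length A F a b \<gamma>) | a b \<gamma>.
        a < b \<and> piecewise_C1_path X A a b \<gamma> \<and> \<gamma> a = x \<and> \<gamma> b = y}"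

end

theory Submission
  imports Defs
begin

text \<open>In a chart around \<open>p\<close> the metric becomes a continuous family of norms on Euclidean
  space; by compactness of the unit sphere the norm at a point near \<open>p\<close> differs from the norm
  \<open>N\<close> at \<open>p\<close> by a factor between \<open>1 - \<delta>\<close> and \<open>1 + \<delta>\<close>. Coordinate segments
  therefore give \<open>d(q, p) \<le> (1 + \<delta>) N(p - q)\<close>. Conversely, a path from \<open>q\<close> to \<open>p\<close>
  that stays in a small coordinate ball has length at least \<open>(1 - \<delta>) N(p - q)\<close>: integrate a linear
  functional supporting \<open>N\<close> in the direction \<open>p - q\<close> along the velocity. A path leaving
  the ball is even longer once \<open>q\<close> is close to \<open>p\<close>. So \<open>d(\<gamma>(t), p) / |t|\<close> has the
  same limit as \<open>N((\<gamma>(t) - p) / t)\<close>, which is \<open>N(\<gamma>'(0))\<close>.\<close>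

section \<open>Auxiliary analysis\<close>

text \<open>Finite-dimensional Hahn-Banach: a hyperplane separates \<open>z\<close> from the convex
  sublevel set of \<open>N\<close> below \<open>N z\<close>; its normal vector, rescaled to take the
  value \<open>N z\<close> at \<open>z\<close>, is the functional.\<close>

lemma seminorm_support:
  fixes N :: "'e::euclidean_space \<Rightarrow> real"
  assumes nonneg: "\<And>w. 0 \<le> N w"
    and scale: "\<And>r w. N (r *\<^sub>R w) = \<bar>r\<bar> * N w"
    and triangle: "\<And>w w'. N (w + w') \<le> N w + N w'"
  obtains l where "\<And>w. l \<bullet> w \<le> N w" "l \<bullet> z = N z"
proof (cases "N z = 0")
  case True
  then show ?thesis using that[of 0] nonneg by simp
next
  case False
  then have pos: "0 < N z" using nonneg[of z] by simp
  have N0: "N 0 = 0" using scale[of 0 0] by simp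
  define S where "S = {w. N w < N z}"
  have "convex S"
  proof (rule convexI)
    fix x y :: 'e and u v :: real
    assume xy: "x \<in> S" "y \<in> S" and uv: "0 \<le> u" "0 \<le> v" "u + v = 1"
    have "N (u *\<^sub>R x + v *\<^sub>R y) \<le> u * N x + v * N y"
      using triangle[of "u *\<^sub>R x" "v *\<^sub>R y"] uv by (simp add: scale)
    also have "\<dots> < N z"
      using xy uv by (intro convex_bound_lt) (auto simp: S_def)
    finally show "u *\<^sub>R x + v *\<^sub>R y \<in> S" by (simp add: S_def)
  qed
  moreover have "0 \<in> S" using pos N0 by (simp add: S_def)
  ultimately obtain a b where a: "a \<noteq> 0" "\<And>x. x \<in> S \<Longrightarrow> a \<bullet> x \<le> b" "b \<le> a \<bullet> z"
    using separating_hyperplane_sets[of S "{z}"] by (auto simp: S_def)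
  \<comment> \<open>A small positive multiple of \<open>a\<close> lies in \<open>S\<close>.
    Evaluating the separation there forces \<open>a \<bullet> z\<close> to be positive, so the
    functional can be rescaled. The summand 1 covers the case \<open>N a = 0\<close>.\<close>
  define s where "s = N z / (N a + 1)"
  have s: "0 < s" "s * N a < N z"
    using pos nonneg[of a] by (auto simp: s_def divide_simps algebra_simps)
  then have "s *\<^sub>R a \<in> S" by (simp add: S_def scale)
  then have "s * (a \<bullet> a) \<le> a \<bullet> z" using a(2)[of "s *\<^sub>R a"] a(3) by simp
  moreover have "0 < s * (a \<bullet> a)" using s a(1) by simp
  ultimately have az: "0 < a \<bullet> z" by linarith
  show ?thesis
  proof (rule that[of "(N z / (a \<bullet> z)) *\<^sub>R a"])
    fix w
    show "((N z / (a \<bullet> z)) *\<^sub>R a) \<bullet> w \<le> N w"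
    \<comment> \<open>\<open>N w\<close> may vanish, so \<open>w\<close> is scaled into
      \<open>S\<close> by means of an arbitrary \<open>\<eta>\<close> above
      \<open>N w\<close>.\<close>
    proof (rule dense_ge)
      fix \<eta> assume \<eta>: "N w < \<eta>"
      then have "0 < \<eta>" using nonneg[of w] by linarith
      have "(N z / \<eta>) *\<^sub>R w \<in> S"
        using \<eta> \<open>0 < \<eta>\<close> pos by (simp add: S_def scale divide_simps)
      then have "N z / \<eta> * (a \<bullet> w) \<le> a \<bullet> z"
        using a(2)[of "(N z / \<eta>) *\<^sub>R w"] a(3) by simp
      then show "((N z / (a \<bullet> z)) *\<^sub>R a) \<bullet> w \<le> \<eta>"
        using \<open>0 < \<eta>\<close> az by (simp add: divide_simps mult.commute)
    qed
  qed (use az in simp)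
qed

text \<open>By homogeneity only unit vectors matter. On a closed ball times the unit sphere, which
  is compact, the ratio of the two norms is uniformly continuous, and it equals 1 at the centre
  \<open>x0\<close>.\<close>

lemma norm_family_nearly_constant:
  fixes N :: "'e::euclidean_space \<Rightarrow> 'e \<Rightarrow> real"
  assumes "open U" "x0 \<in> U" "0 < \<delta>"
    and cont: "continuous_on (U \<times> UNIV) (\<lambda>z. N (fst z) (snd z))"
    and scale: "\<And>x r w. x \<in> U \<Longrightarrow> N x (r *\<^sub>R w) = \<bar>r\<bar> * N x w"
    and pos: "\<And>w. w \<noteq> 0 \<Longrightarrow> 0 < N x0 w"
  obtains r where "0 < r" "cball x0 r \<subseteq> U"
    "\<And>x w. x \<in> cball x0 r \<Longrightarrow> \<bar>N x w - N x0 w\<bar> \<le> \<delta> * N x0 w"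
proof -
  obtain R where R: "0 < R" "cball x0 R \<subseteq> U"
    using assms(1,2) open_contains_cball by blast
  define G where "G = (\<lambda>z. N (fst z) (snd z) / N x0 (snd z))"
  have "continuous_on (cball x0 R \<times> sphere 0 1) G"
    unfolding G_def
  proof (intro continuous_on_divide)
    show "continuous_on (cball x0 R \<times> sphere 0 1) (\<lambda>z. N (fst z) (snd z))"
      using R by (intro continuous_on_subset[OF cont]) auto
    show "continuous_on (cball x0 R \<times> sphere 0 1) (\<lambda>z. N x0 (snd z))"
      using assms(2) by (intro continuous_on_compose2[OF cont, of _ "\<lambda>z. (x0, snd z)", simplified])
        (auto intro!: continuous_intros)
    have "N x0 w \<noteq> 0" if "norm w = 1" for w
      using pos[of w] that by fastforce
    then show "\<forall>z\<in>cball x0 R \<times> sphere 0 1. N x0 (snd z) \<noteq> 0"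
      by auto
  qed
  then have "uniformly_continuous_on (cball x0 R \<times> sphere 0 1) G"
    by (intro compact_uniformly_continuous compact_Times) auto
  then obtain d where d: "0 < d" "\<And>y z. \<lbrakk>y \<in> cball x0 R \<times> sphere 0 1; z \<in> cball x0 R \<times> sphere 0 1;
      dist z y < d\<rbrakk> \<Longrightarrow> dist (G z) (G y) < \<delta>"
    using \<open>0 < \<delta>\<close> unfolding uniformly_continuous_on_def by metis
  show ?thesis
  proof
    \<comment> \<open>Uniform continuity needs distance strictly below \<open>d\<close>, while the
      ball is closed; hence \<open>d/2\<close>.\<close>
    show "0 < min R (d/2)" using R d by simp
    show "cball x0 (min R (d/2)) \<subseteq> U" using R by auto
    fix x w assume x: "x \<in> cball x0 (min R (d/2))"
    then have xU: "x \<in> U" using R by auto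
    show "\<bar>N x w - N x0 w\<bar> \<le> \<delta> * N x0 w"
    proof (cases "w = 0")
      case True
      then show ?thesis using scale[OF xU, of 0 0] scale[OF assms(2), of 0 0] by simp
    next
      case False
      define u where "u = (1 / norm w) *\<^sub>R w"
      have u: "norm u = 1" "w = norm w *\<^sub>R u" using False by (auto simp: u_def)
      have u0: "0 < N x0 u" using pos[of u] u by fastforce
      have "dist (G (x, u)) (G (x0, u)) < \<delta>"
        using x u R d(1) by (intro d(2)) (auto simp: dist_Pair_Pair dist_commute)
      then have "\<bar>N x u / N x0 u - 1\<bar> < \<delta>"
        using u0 by (simp add: G_def dist_real_def)
      moreover have "N x u - N x0 u = (N x u / N x0 u - 1) * N x0 u"
        using u0 by (simp add: field_simps)
      ultimately have "\<bar>N x u - N x0 u\<bar> \<le> \<delta> * N x0 u"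
        using u0 by (simp add: abs_mult)
      then have "norm w * \<bar>N x u - N x0 u\<bar> \<le> norm w * (\<delta> * N x0 u)"
        by (rule mult_left_mono) simp
      moreover have "N x w = norm w * N x u" "N x0 w = norm w * N x0 u"
        using u(2) scale[OF xU, of "norm w" u] scale[OF assms(2), of "norm w" u] by simp_all
      ultimately show ?thesis
        by (simp add: abs_mult flip: right_diff_distrib) (simp add: algebra_simps)
    qed
  qed
qed

text \<open>A squeeze with relative errors: first \<open>\<delta>\<close> is chosen so small that
  the perturbed limit is still on the right side of the test value, and only then the filter is
  used. \<open>D\<close> is extended real because a distance may be infinite.\<close>

lemma tendsto_ereal_relative_error:
  fixes R :: "'b \<Rightarrow> real" and D :: "'b \<Rightarrow> ereal"
  assumes R: "(R \<longlongrightarrow> L) \<F>"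
    and lower: "\<And>\<delta>. 0 < \<delta> \<Longrightarrow> \<delta> < 1 \<Longrightarrow> \<forall>\<^sub>F t in \<F>. ereal ((1 - \<delta>) * R t) \<le> D t"
    and upper: "\<And>\<delta>. 0 < \<delta> \<Longrightarrow> \<delta> < 1 \<Longrightarrow> \<forall>\<^sub>F t in \<F>. D t \<le> ereal ((1 + \<delta>) * R t)"
  shows "(D \<longlongrightarrow> ereal L) \<F>"
proof -
  have ev: "\<forall>\<^sub>F \<delta> in at_right 0. 0 < \<delta> \<and> \<delta> < (1::real)"
    using eventually_at_right_real[of 0 "1::real"] by simp
  have minus: "((\<lambda>\<delta>. ereal ((1 - \<delta>) * L)) \<longlongrightarrow> ereal L) (at_right 0)"
    by (rule tendsto_eq_intros refl | simp)+
  have plus: "((\<lambda>\<delta>. ereal ((1 + \<delta>) * L)) \<longlongrightarrow> ereal L) (at_right 0)"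
    by (rule tendsto_eq_intros refl | simp)+
  show ?thesis
  proof (rule order_tendstoI)
    fix \<alpha> assume "\<alpha> < ereal L"
    then obtain \<delta> where \<delta>: "0 < \<delta>" "\<delta> < 1" "\<alpha> < ereal ((1 - \<delta>) * L)"
      using eventually_conj[OF ev order_tendstoD(1)[OF minus]]
      by (metis (mono_tags, lifting) eventually_happens trivial_limit_at_right_real)
    have "((\<lambda>t. ereal ((1 - \<delta>) * R t)) \<longlongrightarrow> ereal ((1 - \<delta>) * L)) \<F>"
      using R by (intro tendsto_intros)
    then have "\<forall>\<^sub>F t in \<F>. \<alpha> < ereal ((1 - \<delta>) * R t)"
      using \<delta> order_tendstoD by blast
    with lower[OF \<delta>(1,2)] show "\<forall>\<^sub>F t in \<F>. \<alpha> < D t"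
      by eventually_elim (rule less_le_trans)
  next
    fix \<alpha> assume "ereal L < \<alpha>"
    then obtain \<delta> where \<delta>: "0 < \<delta>" "\<delta> < 1" "ereal ((1 + \<delta>) * L) < \<alpha>"
      using eventually_conj[OF ev order_tendstoD(2)[OF plus]]
      by (metis (mono_tags, lifting) eventually_happens trivial_limit_at_right_real)
    have "((\<lambda>t. ereal ((1 + \<delta>) * R t)) \<longlongrightarrow> ereal ((1 + \<delta>) * L)) \<F>"
      using R by (intro tendsto_intros)
    then have "\<forall>\<^sub>F t in \<F>. ereal ((1 + \<delta>) * R t) < \<alpha>"
      using \<delta> order_tendstoD by blast
    with upper[OF \<delta>(1,2)] show "\<forall>\<^sub>F t in \<F>. D t < \<alpha>"
      by eventually_elim (rule le_less_trans)
  qed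
qed

section \<open>Partitions of an interval\<close>

lemma partition_mono:
  fixes \<tau> :: "nat \<Rightarrow> real"
  assumes "\<And>i. i < n \<Longrightarrow> \<tau> i < \<tau> (Suc i)" "i \<le> j" "j \<le> n"
  shows "\<tau> i \<le> \<tau> j"
  using assms(2,3)
proof (induction j rule: dec_induct)
  case (step j)
  then show ?case using assms(1)[of j] by fastforce
qed simp

lemma integrable_on_partition:
  fixes \<tau> :: "nat \<Rightarrow> real" and f :: "real \<Rightarrow> 'b::banach"
  assumes "\<And>i. i < n \<Longrightarrow> \<tau> i < \<tau> (Suc i)" "\<And>i. i < n \<Longrightarrow> f integrable_on {\<tau> i..\<tau> (Suc i)}"
  shows "f integrable_on {\<tau> 0..\<tau> n}"
  using assms
proof (induction n)
  case (Suc n)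
  have "f integrable_on {\<tau> 0..\<tau> n}"
    using Suc by simp
  moreover have "\<tau> 0 \<le> \<tau> n"
    using partition_mono[of n \<tau> 0 n] Suc.prems(1) by simp
  ultimately show ?case
    using Suc.prems(1)[of n] Suc.prems(2)[of n] Henstock_Kurzweil_Integration.integrable_combine
    by (metis lessI less_imp_le)
qed (use integrable_on_refl[of f "\<tau> 0"] in simp)

text \<open>Serves to discard the break points of a piecewise \<open>C1\<close> path: any other time
  lies strictly inside a piece, where one-sided derivatives are ordinary ones.\<close>

lemma partition_cell:
  fixes \<tau> :: "nat \<Rightarrow> real"
  assumes "t \<in> {\<tau> 0..\<tau> n}" "t \<notin> \<tau> ` {..n}"
  obtains i where "i < n" "\<tau> i < t" "t < \<tau> (Suc i)"
  using assms
proof (induction n arbitrary: thesis)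
  case (Suc n)
  show ?case
  proof (cases "t \<le> \<tau> n")
    case True
    with Suc show ?thesis by (metis atLeastAtMost_iff atMost_Suc image_insert insertCI less_SucI)
  next
    case False
    moreover have "t < \<tau> (Suc n)"
      using Suc.prems by (metis atLeastAtMost_iff atMost_iff imageI order.order_iff_strict)
    ultimately show ?thesis using Suc.prems(1)[of n] by simp
  qed
qed auto

lemma islimpt_IccI:
  fixes a b t :: real
  assumes "a < b" "t \<in> {a..b}" shows "t islimpt {a..b}"
  using assms islimpt_Icc by blast

section \<open>Charts and transition maps\<close>

abbreviation chart_inv :: "('a, 'e) chart \<Rightarrow> 'e \<Rightarrow> 'a" where
  "chart_inv c \<equiv> inv_into (fst c) (snd c)"

abbreviation transition_deriv :: "('a, 'e::euclidean_space) chart \<Rightarrow> ('a, 'e) chart \<Rightarrow> 'e \<Rightarrow> 'e \<Rightarrow> 'e"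
  where "transition_deriv c d x \<equiv> frechet_derivative (transition c d) (at x)"

locale manifold =
  fixes k :: enat and X :: "'a topology" and A :: "('a, 'e::euclidean_space) chart set"
  assumes manifold: "differentiable_manifold k X A"
begin

lemma Hausdorff: "Hausdorff_space X"
  using manifold by (simp add: differentiable_manifold_def)

lemma chart_cover: "p \<in> topspace X \<Longrightarrow> \<exists>c\<in>A. p \<in> fst c"
  using manifold unfolding differentiable_manifold_def by blast

context
  fixes c assumes c: "c \<in> A"
begin

lemma openin_chart_domain: "openin X (fst c)"
  and open_chart_range: "open (snd c ` fst c)"
  and homeomorphic_chart:
    "homeomorphic_map (subtopology X (fst c)) (top_of_set (snd c ` fst c)) (snd c)"
  using manifold c by (auto simp: differentiable_manifold_def)

lemma chart_domain_subset: "fst c \<subseteq> topspace X"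
  using openin_chart_domain openin_subset by blast

lemma inj_on_chart: "inj_on (snd c) (fst c)"
  using homeomorphic_imp_injective_map[OF homeomorphic_chart] chart_domain_subset
  by (simp add: Int_absorb1)

lemma chart_inv_chart [simp]: "q \<in> fst c \<Longrightarrow> chart_inv c (snd c q) = q"
  using inj_on_chart by simp

lemma continuous_map_chart: "continuous_map (subtopology X (fst c)) euclidean (snd c)"
  using homeomorphic_imp_continuous_map[OF homeomorphic_chart] continuous_map_in_subtopology by blast

lemma open_chart_image:
  assumes "openin X V" shows "open (snd c ` (fst c \<inter> V))"
proof -
  have "openin (subtopology X (fst c)) (fst c \<inter> V)"
    using assms by (simp add: openin_subtopology_Int2)
  then have "openin (top_of_set (snd c ` fst c)) (snd c ` (fst c \<inter> V))"
    using homeomorphic_imp_open_map[OF homeomorphic_chart] by (simp add: open_map_def)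
  then show ?thesis
    using open_chart_range by (simp add: openin_open_eq)
qed

lemma openin_chart_preimage:
  assumes "open W" shows "openin X {q \<in> fst c. snd c q \<in> W}"
proof -
  have "openin (subtopology X (fst c)) {q \<in> topspace (subtopology X (fst c)). snd c q \<in> W}"
    using continuous_map_chart assms open_openin openin_continuous_map_preimage by blast
  moreover have "{q \<in> topspace (subtopology X (fst c)). snd c q \<in> W} = {q \<in> fst c. snd c q \<in> W}"
    using chart_domain_subset by auto
  ultimately show ?thesis
    using openin_trans_full[OF _ openin_chart_domain] by simp
qed

lemma continuous_map_chart_inv: "continuous_map (top_of_set (snd c ` fst c)) X (chart_inv c)"
proof -
  obtain g where g: "homeomorphic_maps (subtopology X (fst c)) (top_of_set (snd c ` fst c)) (snd c) g"
    using homeomorphic_chart homeomorphic_map_maps by blast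
  have "continuous_map (top_of_set (snd c ` fst c)) X g"
    using g by (auto simp: homeomorphic_maps_def continuous_map_in_subtopology)
  \<comment> \<open>The topological inverse \<open>g\<close> agrees with \<open>inv_into\<close> on
    the chart range, which transfers its continuity.\<close>
  moreover have "g x = chart_inv c x" if "x \<in> snd c ` fst c" for x
    using g that chart_domain_subset by (auto simp: homeomorphic_maps_def)
  ultimately show ?thesis
    by (auto intro: continuous_map_eq)
qed

lemma transition_chart [simp]: "q \<in> fst c \<Longrightarrow> transition c d (snd c q) = snd d q"
  by (simp add: transition_def)

context
  fixes d assumes d: "d \<in> A"
begin

lemma open_overlap: "open (snd c ` (fst c \<inter> fst d))"
  using open_chart_image manifold d by (simp add: differentiable_manifold_def)

lemma Cn_on_transition: "Cn_on 1 (transition c d) (snd c ` (fst c \<inter> fst d))"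
  using manifold c d
  by (auto simp: differentiable_manifold_def class_on_def one_enat_def simp del: One_nat_def)

lemma transition_has_derivative:
  assumes "q \<in> fst c" "q \<in> fst d"
  shows "(transition c d has_derivative transition_deriv c d (snd c q)) (at (snd c q))"
  using Cn_on_transition assms by (auto simp: frechet_derivative_works)

lemma linear_transition_deriv:
  assumes "q \<in> fst c" "q \<in> fst d"
  shows "linear (transition_deriv c d (snd c q))"
  using transition_has_derivative[OF assms] has_derivative_linear by blast

lemma continuous_on_transition: "continuous_on (snd c ` (fst c \<inter> fst d)) (transition c d)"
  using transition_has_derivative has_derivative_continuous
  by (intro continuous_at_imp_continuous_on) blast

lemma continuous_on_transition_deriv:
  "continuous_on (snd c ` (fst c \<inter> fst d)) (\<lambda>x. transition_deriv c d x w)"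
  using Cn_on_transition by simp

text \<open>\<open>Cn_on\<close> yields continuity for one direction \<open>w\<close> at a time;
  linearity in \<open>w\<close> and a finite basis upgrade this to joint continuity.\<close>

lemma continuous_on_transition_deriv_joint:
  "continuous_on (snd c ` (fst c \<inter> fst d) \<times> UNIV) (\<lambda>(x, w). transition_deriv c d x w)"
proof -
  have "continuous_on (snd c ` (fst c \<inter> fst d) \<times> UNIV)
     (\<lambda>z. \<Sum>b\<in>Basis. (snd z \<bullet> b) *\<^sub>R transition_deriv c d (fst z) b)"
    by (intro continuous_intros continuous_on_compose2[OF continuous_on_transition_deriv]) auto
  moreover have "transition_deriv c d x w = (\<Sum>b\<in>Basis. (w \<bullet> b) *\<^sub>R transition_deriv c d x b)"
    if "x \<in> snd c ` (fst c \<inter> fst d)" for x w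
  proof -
    have lin: "linear (transition_deriv c d x)"
      using that linear_transition_deriv by auto
    have "transition_deriv c d x w = transition_deriv c d x (\<Sum>b\<in>Basis. (w \<bullet> b) *\<^sub>R b)"
      by (simp add: euclidean_representation)
    also have "\<dots> = (\<Sum>b\<in>Basis. (w \<bullet> b) *\<^sub>R transition_deriv c d x b)"
      by (simp add: linear_sum[OF lin] linear_cmul[OF lin])
    finally show ?thesis .
  qed
  ultimately show ?thesis
    by (elim continuous_on_eq) auto
qed

end

text \<open>The transition from a chart to itself is the identity on the open chart range, so
  uniqueness of derivatives applies.\<close>

lemma transition_deriv_self:
  assumes "q \<in> fst c" shows "transition_deriv c c (snd c q) w = w"
proof -
  have "((\<lambda>x. x) has_derivative transition_deriv c c (snd c q)) (at (snd c q))"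
    by (rule has_derivative_transform_within_open[OF transition_has_derivative[OF c assms assms]
      open_chart_range]) (use assms in auto)
  then show ?thesis
    using has_derivative_unique[OF _ has_derivative_ident] by metis
qed

text \<open>Chain rule: on the open overlap of \<open>c\<close> and \<open>d\<close> the composed
  transitions coincide with the direct one. This cocycle law is what makes a family of components
  built from one chart consistent.\<close>

lemma transition_deriv_compose:
  assumes "d \<in> A" "e \<in> A" "q \<in> fst c" "q \<in> fst d" "q \<in> fst e"
  shows "transition_deriv d e (snd d q) (transition_deriv c d (snd c q) w)
    = transition_deriv c e (snd c q) w"
proof -
  have de: "(transition d e has_derivative transition_deriv d e (snd d q)) (at (transition c d (snd c q)))"
    using manifold.transition_has_derivative[OF manifold_axioms, of d e q] assms by simp
  have "(transition d e \<circ> transition c d has_derivative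
      transition_deriv d e (snd d q) \<circ> transition_deriv c d (snd c q)) (at (snd c q))"
    using diff_chain_at[OF transition_has_derivative de] assms by blast
  then have "(transition c e has_derivative
      transition_deriv d e (snd d q) \<circ> transition_deriv c d (snd c q)) (at (snd c q))"
  proof (rule has_derivative_transform_within_open)
    show "open (snd c ` (fst c \<inter> fst d))"
      using open_overlap assms by simp
    show "(transition d e \<circ> transition c d) x = transition c e x"
      if "x \<in> snd c ` (fst c \<inter> fst d)" for x
      using that assms manifold.transition_chart[OF manifold_axioms, of d _ e] by auto
  qed (use assms in auto)
  then have "transition_deriv c e (snd c q) = transition_deriv d e (snd d q) \<circ> transition_deriv c d (snd c q)"
    using transition_has_derivative[OF assms(2,3,5)] has_derivative_unique by blast
  then show ?thesis by simp
qed

end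

section \<open>Tangent vectors in a chart\<close>

text \<open>The inverse of the component map \<open>v \<mapsto> v c\<close>, identifying the model
  space with the tangent space at \<open>q\<close>. The default 0 is the one prescribed by
  \<open>tangent_space\<close>.\<close>

definition tvec :: "('a, 'e) chart \<Rightarrow> 'a \<Rightarrow> 'e \<Rightarrow> ('a, 'e) tangent_vector" where
  "tvec c q w = (\<lambda>d. if d \<in> A \<and> q \<in> fst d then transition_deriv c d (snd c q) w else 0)"

lemma tvec_in_tangent_space:
  assumes "c \<in> A" "q \<in> fst c" shows "tvec c q w \<in> tangent_space A q"
  using assms by (auto simp: tangent_space_def tvec_def transition_deriv_compose)

lemma tvec_component:
  assumes "c \<in> A" "q \<in> fst c" shows "tvec c q w c = w"
  using assms by (simp add: tvec_def transition_deriv_self)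

lemma tvec_of_component:
  assumes "c \<in> A" "q \<in> fst c" "v \<in> tangent_space A q" shows "tvec c q (v c) = v"
proof
  fix d
  show "tvec c q (v c) d = v d"
  proof (cases "d \<in> A \<and> q \<in> fst d")
    case True
    then have "v d = transition_deriv c d (snd c q) (v c)"
      using assms unfolding tangent_space_def by blast
    with True show ?thesis by (simp add: tvec_def)
  next
    case False
    then have "v d = 0"
      using assms(3) unfolding tangent_space_def by blast
    with False show ?thesis unfolding tvec_def by argo
  qed
qed

lemma tvec_scale:
  assumes "c \<in> A" "q \<in> fst c" shows "tvec c q (r *\<^sub>R w) = (\<lambda>d. r *\<^sub>R tvec c q w d)"
  using assms by (auto simp: tvec_def linear_cmul[OF linear_transition_deriv])

lemma tvec_add:
  assumes "c \<in> A" "q \<in> fst c" shows "tvec c q (w + w') = (\<lambda>d. tvec c q w d + tvec c q w' d)"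
  using assms by (auto simp: tvec_def linear_add[OF linear_transition_deriv])

lemma tangent_bundle_mem:
  "q \<in> topspace X \<Longrightarrow> v \<in> tangent_space A q \<Longrightarrow> (q, v) \<in> tangent_bundle X A"
  by (simp add: tangent_bundle_def)

text \<open>As the topology is generated by preimages under bundle charts, only these need checking.
  Such a preimage is open relative to the part of \<open>S\<close> mapped into one chart, and
  \<open>domain\<close> makes it open relative to \<open>S\<close>.\<close>

lemma continuous_map_into_tangent_bundle:
  fixes S :: "'b::topological_space set"
  assumes tangent: "\<And>s. s \<in> S \<Longrightarrow> \<sigma> s \<in> topspace X \<and> V s \<in> tangent_space A (\<sigma> s)"
    and domain: "\<And>c. c \<in> A \<Longrightarrow> openin (top_of_set S) {s \<in> S. \<sigma> s \<in> fst c}"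
    and cont: "\<And>c. c \<in> A \<Longrightarrow> continuous_on {s \<in> S. \<sigma> s \<in> fst c} (\<lambda>s. (snd c (\<sigma> s), V s c))"
  shows "continuous_map (top_of_set S) (tangent_bundle_topology X A) (\<lambda>s. (\<sigma> s, V s))"
  unfolding tangent_bundle_topology_def
proof (rule continuous_on_generated_topo)
  fix B assume "B \<in> {{(p, v) \<in> tangent_bundle X A. p \<in> fst c \<and> (snd c p, v c) \<in> W} | c W.
     c \<in> A \<and> open (W :: ('e \<times> 'e) set)}"
  then obtain c W where c: "c \<in> A" and W: "open W"
    and B: "B = {(p, v) \<in> tangent_bundle X A. p \<in> fst c \<and> (snd c p, v c) \<in> W}"
    by blast
  have "openin (top_of_set {s \<in> S. \<sigma> s \<in> fst c})
      ({s \<in> S. \<sigma> s \<in> fst c} \<inter> (\<lambda>s. (snd c (\<sigma> s), V s c)) -` W)"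
    using cont[OF c] W continuous_openin_preimage_gen by blast
  then have "openin (top_of_set S)
      ({s \<in> S. \<sigma> s \<in> fst c} \<inter> (\<lambda>s. (snd c (\<sigma> s), V s c)) -` W)"
    using domain[OF c] openin_trans by blast
  moreover have "(\<lambda>s. (\<sigma> s, V s)) -` B \<inter> S
      = {s \<in> S. \<sigma> s \<in> fst c} \<inter> (\<lambda>s. (snd c (\<sigma> s), V s c)) -` W"
    using tangent by (auto simp: B tangent_bundle_def)
  ultimately show "openin (top_of_set S) ((\<lambda>s. (\<sigma> s, V s)) -` B \<inter> topspace (top_of_set S))"
    by simp
next
  have "(\<sigma> s, V s) \<in> \<Union> {{(p, v) \<in> tangent_bundle X A. p \<in> fst c \<and> (snd c p, v c) \<in> W} | c W.
     c \<in> A \<and> open (W :: ('e \<times> 'e) set)}" if "s \<in> S" for s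
  proof -
    obtain c where c: "c \<in> A" "\<sigma> s \<in> fst c"
      using tangent[OF \<open>s \<in> S\<close>] chart_cover by blast
    show ?thesis
    \<comment> \<open>The choice \<open>W = UNIV\<close> with a chart around the base point gives a
      generator containing the pair.\<close>
    proof (rule UnionI)
      show "{(p, v) \<in> tangent_bundle X A. p \<in> fst c \<and> (snd c p, v c) \<in> UNIV}
        \<in> {{(p, v) \<in> tangent_bundle X A. p \<in> fst c \<and> (snd c p, v c) \<in> W} | c W.
            c \<in> A \<and> open (W :: ('e \<times> 'e) set)}"
        using c(1) by blast
      show "(\<sigma> s, V s) \<in> {(p, v) \<in> tangent_bundle X A. p \<in> fst c \<and> (snd c p, v c) \<in> UNIV}"
        using c(2) tangent[OF \<open>s \<in> S\<close>] tangent_bundle_mem by simp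
    qed
  qed
  then show "(\<lambda>s. (\<sigma> s, V s)) ` topspace (top_of_set S) \<subseteq> \<Union> {{(p, v) \<in> tangent_bundle X A. p \<in> fst c \<and> (snd c p, v c) \<in> W} | c W.
     c \<in> A \<and> open (W :: ('e \<times> 'e) set)}"
    by auto
qed

text \<open>Seen in another chart \<open>d\<close>, this inverse of a bundle chart is the transition
  map paired with its derivative, and both are continuous on the overlap.\<close>

lemma continuous_map_tvec:
  assumes c: "c \<in> A"
  shows "continuous_map (top_of_set (snd c ` fst c \<times> UNIV)) (tangent_bundle_topology X A)
    (\<lambda>z. (chart_inv c (fst z), tvec c (chart_inv c (fst z)) (snd z)))"
proof (rule continuous_map_into_tangent_bundle)
  show "chart_inv c (fst z) \<in> topspace X \<and>
      tvec c (chart_inv c (fst z)) (snd z) \<in> tangent_space A (chart_inv c (fst z))"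
    if "z \<in> snd c ` fst c \<times> UNIV" for z
    using that c chart_domain_subset[OF c] tvec_in_tangent_space[OF c] by auto
next
  fix d assume d: "d \<in> A"
  have eq: "{z \<in> snd c ` fst c \<times> UNIV. chart_inv c (fst z) \<in> fst d}
      = snd c ` (fst c \<inter> fst d) \<times> UNIV"
    using c by auto
  have "open (snd c ` (fst c \<inter> fst d) \<times> UNIV)"
    using open_overlap[OF c d] by (intro open_Times) auto
  then show "openin (top_of_set (snd c ` fst c \<times> UNIV))
      {z \<in> snd c ` fst c \<times> UNIV. chart_inv c (fst z) \<in> fst d}"
    unfolding eq by (intro open_subset) blast+
  have "continuous_on (snd c ` (fst c \<inter> fst d) \<times> UNIV)
      (\<lambda>z. (transition c d (fst z), transition_deriv c d (fst z) (snd z)))"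
    using continuous_on_transition_deriv_joint[OF c d]
    by (intro continuous_intros continuous_on_compose2[OF continuous_on_transition[OF c d]])
      (auto simp: case_prod_unfold)
  then show "continuous_on {z \<in> snd c ` fst c \<times> UNIV. chart_inv c (fst z) \<in> fst d}
      (\<lambda>z. (snd d (chart_inv c (fst z)), tvec c (chart_inv c (fst z)) (snd z) d))"
    unfolding eq by (rule continuous_on_eq) (use c d in \<open>auto simp: tvec_def\<close>)
qed

section \<open>Velocities\<close>

lemma openin_curve_preimage:
  fixes I :: "real set"
  assumes "continuous_map (top_of_set I) X \<sigma>" "openin X U"
  shows "openin (top_of_set I) {t \<in> I. \<sigma> t \<in> U}"
  using openin_continuous_map_preimage[OF assms] by simp

lemma continuous_on_chart_curve:
  fixes I :: "real set"
  assumes "continuous_map (top_of_set I) X \<sigma>" "c \<in> A" "J \<subseteq> {t \<in> I. \<sigma> t \<in> fst c}"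
  shows "continuous_on J (snd c \<circ> \<sigma>)"
proof -
  have "continuous_map (top_of_set J) (subtopology X (fst c)) \<sigma>"
    using assms continuous_map_from_subtopology_mono[OF assms(1), of J]
    by (auto simp: continuous_map_in_subtopology)
  then have "continuous_map (top_of_set J) euclidean (snd c \<circ> \<sigma>)"
    using continuous_map_chart[OF assms(2)] continuous_map_compose by blast
  then show ?thesis by simp
qed

lemma chart_curve_has_vector_derivative:
  assumes "differentiable_curve_on X A I \<sigma>" "c \<in> A" "t \<in> I" "\<sigma> t \<in> fst c"
  shows "((snd c \<circ> \<sigma>) has_vector_derivative velocity A I \<sigma> t c) (at t within I)"
  using assms vector_derivative_works by (auto simp: differentiable_curve_on_def velocity_def)

text \<open>Chain rule along the curve, taken within \<open>I\<close> so that one-sided derivatives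
  at end points are covered.\<close>

lemma velocity_transition:
  assumes \<sigma>: "continuous_map (top_of_set I) X \<sigma>" and c: "c \<in> A" and d: "d \<in> A"
    and t: "t \<in> I" "\<sigma> t \<in> fst c" "\<sigma> t \<in> fst d"
    and der: "((snd c \<circ> \<sigma>) has_vector_derivative w) (at t within I)"
  shows "((snd d \<circ> \<sigma>) has_vector_derivative transition_deriv c d (snd c (\<sigma> t)) w) (at t within I)"
proof -
  have "(transition c d has_derivative transition_deriv c d (snd c (\<sigma> t)))
      (at ((snd c \<circ> \<sigma>) t) within (snd c \<circ> \<sigma>) ` I)"
    using transition_has_derivative[OF c d t(2,3)] by (simp add: has_derivative_at_withinI)
  then have comp: "((transition c d \<circ> (snd c \<circ> \<sigma>)) has_vector_derivative
      transition_deriv c d (snd c (\<sigma> t)) w) (at t within I)"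
    by (rule vector_derivative_diff_chain_within[OF der])
  \<comment> \<open>The two coordinate expressions are known to agree while the curve is in the
    domain of \<open>c\<close>; continuity keeps it there near \<open>t\<close>.\<close>
  have "openin (top_of_set I) {s \<in> I. \<sigma> s \<in> fst c}"
    using openin_curve_preimage[OF \<sigma> openin_chart_domain[OF c]] .
  then obtain \<epsilon> where "0 < \<epsilon>" "\<And>s. s \<in> I \<Longrightarrow> dist s t < \<epsilon> \<Longrightarrow> \<sigma> s \<in> fst c"
    using t(1,2) unfolding openin_euclidean_subtopology_iff by blast
  then show ?thesis
    using c t(1) by (intro has_vector_derivative_transform_within[OF comp]) auto
qed

text \<open>At a limit point of \<open>I\<close> derivatives within \<open>I\<close> are unique, so
  the components in two charts must be related by the chain rule.\<close>

lemma velocity_in_tangent_space: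
  assumes \<sigma>: "differentiable_curve_on X A I \<sigma>" and t: "t \<in> I" "t islimpt I"
  shows "velocity A I \<sigma> t \<in> tangent_space A (\<sigma> t)"
proof -
  have "velocity A I \<sigma> t d = transition_deriv c d (snd c (\<sigma> t)) (velocity A I \<sigma> t c)"
    if "c \<in> A" "d \<in> A" "\<sigma> t \<in> fst c" "\<sigma> t \<in> fst d" for c d
  proof -
    have "continuous_map (top_of_set I) X \<sigma>"
      using \<sigma> by (simp add: differentiable_curve_on_def)
    then have "((snd d \<circ> \<sigma>) has_vector_derivative
        transition_deriv c d (snd c (\<sigma> t)) (velocity A I \<sigma> t c)) (at t within I)"
      using velocity_transition chart_curve_has_vector_derivative[OF \<sigma>] that t by blast
    moreover have "at t within I \<noteq> bot"
      using t(2) by (simp add: trivial_limit_within)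
    ultimately show ?thesis
      using chart_curve_has_vector_derivative[OF \<sigma> that(2) t(1) that(4)]
        vector_derivative_unique_within by blast
  qed
  moreover have "velocity A I \<sigma> t c = 0" if "\<not> (c \<in> A \<and> \<sigma> t \<in> fst c)" for c
    using that unfolding velocity_def by argo
  ultimately show ?thesis
    unfolding tangent_space_def by blast
qed

text \<open>Together with continuity of \<open>F\<close> on the tangent bundle this makes the
  integrand of the length continuous on each \<open>C1\<close> piece.\<close>

lemma continuous_map_velocity:
  assumes \<sigma>: "C1_curve_on X A I \<sigma>" and I: "\<And>t. t \<in> I \<Longrightarrow> t islimpt I"
  shows "continuous_map (top_of_set I) (tangent_bundle_topology X A) (\<lambda>t. (\<sigma> t, velocity A I \<sigma> t))"
proof (rule continuous_map_into_tangent_bundle)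
  have \<sigma>': "differentiable_curve_on X A I \<sigma>" "continuous_map (top_of_set I) X \<sigma>"
    using \<sigma> by (auto simp: C1_curve_on_def differentiable_curve_on_def)
  show "\<sigma> t \<in> topspace X \<and> velocity A I \<sigma> t \<in> tangent_space A (\<sigma> t)" if "t \<in> I" for t
    using velocity_in_tangent_space[OF \<sigma>'(1) that I[OF that]]
      continuous_map_image_subset_topspace[OF \<sigma>'(2)] that by auto
  fix c assume c: "c \<in> A"
  show "openin (top_of_set I) {t \<in> I. \<sigma> t \<in> fst c}"
    using openin_curve_preimage[OF \<sigma>'(2) openin_chart_domain[OF c]] .
  show "continuous_on {t \<in> I. \<sigma> t \<in> fst c} (\<lambda>t. (snd c (\<sigma> t), velocity A I \<sigma> t c))"
    using \<sigma> c continuous_on_chart_curve[OF \<sigma>'(2) c order.refl]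
    by (intro continuous_on_Pair) (auto simp: C1_curve_on_def o_def)
qed

end

section \<open>Finsler metrics and lengths of paths\<close>

locale finsler_manifold = manifold +
  fixes F
  assumes finsler: "finsler_metric X A F"
begin

section \<open>The metric read in a chart\<close>

text \<open>The coordinate form of \<open>F\<close>: a family of norms on the model space, indexed
  by the points \<open>x\<close> of the chart range.\<close>

definition chart_norm :: "('a, 'b) chart \<Rightarrow> 'b \<Rightarrow> 'b \<Rightarrow> real" where
  "chart_norm c x w = F (chart_inv c x) (tvec c (chart_inv c x) w)"

lemma norm_on_tangent_space: "q \<in> topspace X \<Longrightarrow> is_norm_on (tangent_space A q) (F q)"
  using finsler by (simp add: finsler_metric_def)

lemma F_nonneg: "q \<in> topspace X \<Longrightarrow> w \<in> tangent_space A q \<Longrightarrow> 0 \<le> F q w"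
  using norm_on_tangent_space by (simp add: is_norm_on_def)

lemma continuous_on_F:
  fixes S :: "'c::topological_space set"
  assumes "continuous_map (top_of_set S) (tangent_bundle_topology X A) (\<lambda>s. (\<sigma> s, V s))"
  shows "continuous_on S (\<lambda>s. F (\<sigma> s) (V s))"
proof -
  have "continuous_map (top_of_set S) euclideanreal ((\<lambda>(p, v). F p v) \<circ> (\<lambda>s. (\<sigma> s, V s)))"
    using assms finsler continuous_map_compose unfolding finsler_metric_def by blast
  then show ?thesis by (simp add: o_def)
qed

context
  fixes c assumes c: "c \<in> A"
begin

lemma continuous_on_chart_norm:
  "continuous_on (snd c ` fst c \<times> UNIV) (\<lambda>z. chart_norm c (fst z) (snd z))"
  unfolding chart_norm_def using continuous_on_F[OF continuous_map_tvec[OF c]] .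

lemma F_eq_chart_norm:
  assumes "q \<in> fst c" "v \<in> tangent_space A q"
  shows "F q v = chart_norm c (snd c q) (v c)"
  using c assms by (simp add: chart_norm_def tvec_of_component)

context
  fixes x assumes x: "x \<in> snd c ` fst c"
begin

lemma chart_norm_facts:
  shows chart_norm_nonneg: "0 \<le> chart_norm c x w"
    and chart_norm_scale: "chart_norm c x (r *\<^sub>R w) = \<bar>r\<bar> * chart_norm c x w"
    and chart_norm_triangle: "chart_norm c x (w + w') \<le> chart_norm c x w + chart_norm c x w'"
    and chart_norm_pos: "w \<noteq> 0 \<Longrightarrow> 0 < chart_norm c x w"
proof -
  obtain q where q: "q \<in> fst c" "x = snd c q" using x by blast
  have inv: "chart_inv c x = q" using q c by simp
  have norm: "is_norm_on (tangent_space A q) (F q)"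
    using norm_on_tangent_space q chart_domain_subset[OF c] by blast
  note tv = tvec_in_tangent_space[OF c q(1)]
  show nonneg: "0 \<le> chart_norm c x w"
    using norm tv unfolding is_norm_on_def chart_norm_def inv by blast
  show "chart_norm c x (r *\<^sub>R w) = \<bar>r\<bar> * chart_norm c x w"
    using norm tv unfolding is_norm_on_def chart_norm_def inv tvec_scale[OF c q(1)] by blast
  show "chart_norm c x (w + w') \<le> chart_norm c x w + chart_norm c x w'"
    using norm tv unfolding is_norm_on_def chart_norm_def inv tvec_add[OF c q(1)] by blast
  assume "w \<noteq> 0"
  then have "tvec c q w \<noteq> (\<lambda>_. 0)"
    using tvec_component[OF c q(1), of w] by metis
  then have "F q (tvec c q w) \<noteq> 0"
    using norm tv[of w] unfolding is_norm_on_def by blast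
  then show "0 < chart_norm c x w"
    using nonneg unfolding chart_norm_def inv by simp
qed

lemma chart_norm_minus: "chart_norm c x (w - w') = chart_norm c x (w' - w)"
  using chart_norm_scale[of "-1" "w' - w"] by simp

lemma continuous_on_chart_norm_at: "continuous_on UNIV (chart_norm c x)"
  using x by (intro continuous_on_compose2[OF continuous_on_chart_norm, of _ "\<lambda>w. (x, w)", simplified])
    (auto intro!: continuous_on_Pair continuous_on_const continuous_on_id)

text \<open>\<open>m\<close> is the minimum of the norm on the unit sphere, attained by compactness
  and positive by definiteness.\<close>

lemma chart_norm_lower_bound:
  obtains m where "0 < m" "\<And>w. m * norm w \<le> chart_norm c x w"
proof -
  obtain b :: 'b where b: "b \<in> Basis" using nonempty_Basis by blast
  have "sphere 0 1 \<noteq> ({} :: 'b set)" using b by force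
  then obtain u where u: "norm u = 1" "\<And>w. norm w = 1 \<Longrightarrow> chart_norm c x u \<le> chart_norm c x w"
    using continuous_attains_inf[of "sphere 0 1" "chart_norm c x"]
      continuous_on_subset[OF continuous_on_chart_norm_at] by auto
  show ?thesis
  proof
    show "0 < chart_norm c x u" using chart_norm_pos[of u] u(1) by fastforce
    fix w
    show "chart_norm c x u * norm w \<le> chart_norm c x w"
    proof (cases "w = 0")
      case True
      then show ?thesis using chart_norm_nonneg by simp
    next
      case False
      then have "chart_norm c x w = norm w * chart_norm c x ((1 / norm w) *\<^sub>R w)"
        by (simp add: chart_norm_scale)
      moreover have "chart_norm c x u \<le> chart_norm c x ((1 / norm w) *\<^sub>R w)"
        using False by (intro u(2)) simp
      ultimately show ?thesis
        by (simp add: mult.commute mult_left_mono)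
    qed
  qed
qed

end

end

section \<open>Lower bounds for the length of paths\<close>

text \<open>The length uses velocities relative to the whole interval, the \<open>C1\<close>
  condition those relative to single pieces. Strictly inside a piece both are ordinary derivatives
  and agree, and the finitely many break points do not affect integrability.\<close>

lemma piecewise_C1_path_regular:
  assumes "a < b" and path: "piecewise_C1_path X A a b \<sigma>"
  shows "(\<lambda>t. F (\<sigma> t) (velocity A {a..b} \<sigma> t)) integrable_on {a..b}"
    and "\<exists>S. finite S \<and> (\<forall>t\<in>{a..b} - S. velocity A {a..b} \<sigma> t \<in> tangent_space A (\<sigma> t) \<and>
      (\<forall>c\<in>A. \<sigma> t \<in> fst c \<longrightarrow>
        ((snd c \<circ> \<sigma>) has_vector_derivative velocity A {a..b} \<sigma> t c) (at t)))"
proof -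
  obtain n :: nat and \<tau> where \<tau>: "\<tau> 0 = a" "\<tau> n = b"
    and step: "\<And>i. i < n \<Longrightarrow> \<tau> i < \<tau> (Suc i)"
    and C1: "\<And>i. i < n \<Longrightarrow> C1_curve_on X A {\<tau> i..\<tau> (Suc i)} \<sigma>"
    using path unfolding piecewise_C1_path_def by blast
  have at: "at t within {\<tau> i..\<tau> (Suc i)} = at t" "at t within {a..b} = at t"
    if "i < n" "\<tau> i < t" "t < \<tau> (Suc i)" for i t
  proof -
    have "a \<le> \<tau> i" "\<tau> (Suc i) \<le> b"
      using partition_mono[of n \<tau> 0 i] partition_mono[of n \<tau> "Suc i" n] step \<tau> that by auto
    then show "at t within {\<tau> i..\<tau> (Suc i)} = at t" "at t within {a..b} = at t"
      using that by (auto intro!: at_within_Icc_at)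
  qed
  have velocity: "velocity A {a..b} \<sigma> t = velocity A {\<tau> i..\<tau> (Suc i)} \<sigma> t"
    if "i < n" "\<tau> i < t" "t < \<tau> (Suc i)" for i t
    unfolding velocity_def at[OF that] by (rule refl)
  show "(\<lambda>t. F (\<sigma> t) (velocity A {a..b} \<sigma> t)) integrable_on {a..b}"
  proof -
    have "(\<lambda>t. F (\<sigma> t) (velocity A {a..b} \<sigma> t)) integrable_on {\<tau> i..\<tau> (Suc i)}" if i: "i < n" for i
    \<comment> \<open>The velocity relative to the piece gives an integrand continuous up to the end
      points, and only there can the two integrands differ.\<close>
    proof (rule integrable_spike_finite[of "{\<tau> i, \<tau> (Suc i)}"])
      have "continuous_on {\<tau> i..\<tau> (Suc i)} (\<lambda>t. F (\<sigma> t) (velocity A {\<tau> i..\<tau> (Suc i)} \<sigma> t))"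
        using islimpt_IccI[OF step[OF i]]
        by (intro continuous_on_F continuous_map_velocity C1 i)
      then show "(\<lambda>t. F (\<sigma> t) (velocity A {\<tau> i..\<tau> (Suc i)} \<sigma> t)) integrable_on {\<tau> i..\<tau> (Suc i)}"
        by (rule integrable_continuous_real)
      show "F (\<sigma> t) (velocity A {a..b} \<sigma> t) = F (\<sigma> t) (velocity A {\<tau> i..\<tau> (Suc i)} \<sigma> t)"
        if "t \<in> {\<tau> i..\<tau> (Suc i)} - {\<tau> i, \<tau> (Suc i)}" for t
        using velocity[OF i, of t] that by simp
    qed simp
    from integrable_on_partition[of n \<tau>, OF step this] show ?thesis
      by (simp add: \<tau>)
  qed
  show "\<exists>S. finite S \<and> (\<forall>t\<in>{a..b} - S. velocity A {a..b} \<sigma> t \<in> tangent_space A (\<sigma> t) \<and>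
      (\<forall>c\<in>A. \<sigma> t \<in> fst c \<longrightarrow>
        ((snd c \<circ> \<sigma>) has_vector_derivative velocity A {a..b} \<sigma> t c) (at t)))"
  \<comment> \<open>The exceptional set contains \<open>a\<close> and \<open>b\<close> besides the
    inner break points, so that two-sided derivatives exist elsewhere.\<close>
  proof (intro exI[of _ "\<tau> ` {..n}"] conjI ballI impI)
    fix t assume "t \<in> {a..b} - \<tau> ` {..n}"
    then obtain i where i: "i < n" "\<tau> i < t" "t < \<tau> (Suc i)"
      using partition_cell[of t \<tau> n] \<tau> by auto
    then have t: "t \<in> {\<tau> i..\<tau> (Suc i)}" by simp
    have diff: "differentiable_curve_on X A {\<tau> i..\<tau> (Suc i)} \<sigma>"
      using C1[OF i(1)] by (simp add: C1_curve_on_def)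
    show "velocity A {a..b} \<sigma> t \<in> tangent_space A (\<sigma> t)"
      using velocity_in_tangent_space[OF diff t islimpt_IccI[OF step[OF i(1)] t]]
      by (simp add: velocity[OF i])
    show "((snd c \<circ> \<sigma>) has_vector_derivative velocity A {a..b} \<sigma> t c) (at t)"
      if "c \<in> A" "\<sigma> t \<in> fst c" for c
      using chart_curve_has_vector_derivative[OF diff that(1) t that(2)]
      by (simp add: velocity[OF i] at(1)[OF i])
  qed simp
qed

text \<open>A functional \<open>l\<close> supporting the norm at \<open>x0\<close> in the direction
  of the displacement is integrated along the velocity: it stays below the norm, yet its increment
  is the full norm of the displacement. Replacing the norm along the path by the one at
  \<open>x0\<close> costs the factor \<open>\<kappa>\<close>.\<close>

lemma finsler_length_ge:
  assumes "a < b" and path: "piecewise_C1_path X A a b \<sigma>"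
    and c: "c \<in> A" and x0: "x0 \<in> snd c ` fst c" and s: "s \<in> {a..b}"
    and dom: "\<And>t. t \<in> {s..b} \<Longrightarrow> \<sigma> t \<in> fst c"
    and "0 \<le> \<kappa>"
    and near: "\<And>t w. t \<in> {s..b} \<Longrightarrow> \<kappa> * chart_norm c x0 w \<le> chart_norm c (snd c (\<sigma> t)) w"
  shows "\<kappa> * chart_norm c x0 (snd c (\<sigma> b) - snd c (\<sigma> s)) \<le> finsler_length A F a b \<sigma>"
proof -
  obtain S where S: "finite S"
    and tangent: "\<And>t. t \<in> {a..b} - S \<Longrightarrow> velocity A {a..b} \<sigma> t \<in> tangent_space A (\<sigma> t)"
    and deriv: "\<And>t. t \<in> {a..b} - S \<Longrightarrow> \<sigma> t \<in> fst c \<Longrightarrow>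
      ((snd c \<circ> \<sigma>) has_vector_derivative velocity A {a..b} \<sigma> t c) (at t)"
    using piecewise_C1_path_regular(2)[OF \<open>a < b\<close> path] c by blast
  obtain l where l: "\<And>w. l \<bullet> w \<le> chart_norm c x0 w"
      "l \<bullet> (snd c (\<sigma> b) - snd c (\<sigma> s)) = chart_norm c x0 (snd c (\<sigma> b) - snd c (\<sigma> s))"
    using seminorm_support[of "chart_norm c x0"] chart_norm_facts[OF c x0] by metis
  \<comment> \<open>Both integrands are set to 0 on \<open>S\<close>, where the velocity need not be
    a tangent vector; the pointwise inequalities then hold without exceptions.\<close>
  define f where "f t = (if t \<in> S then 0 else F (\<sigma> t) (velocity A {a..b} \<sigma> t))" for t
  define g where "g t = (if t \<in> S then 0 else \<kappa> * (l \<bullet> velocity A {a..b} \<sigma> t c))" for t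
  have \<sigma>: "continuous_map (top_of_set {a..b}) X \<sigma>"
    using path by (simp add: piecewise_C1_path_def)
  have space: "\<sigma> t \<in> topspace X" if "t \<in> {a..b}" for t
    using continuous_map_image_subset_topspace[OF \<sigma>] that by auto
  have f_int: "f integrable_on {a..b}"
    by (rule integrable_spike_finite[OF S _ piecewise_C1_path_regular(1)[OF \<open>a < b\<close> path]])
      (simp add: f_def)
  have f_nonneg: "0 \<le> f t" if "t \<in> {a..b}" for t
    using that F_nonneg space tangent by (simp add: f_def)
  have "continuous_on {s..b} (snd c \<circ> \<sigma>)"
    using s dom by (intro continuous_on_chart_curve[OF \<sigma> c]) auto
  \<comment> \<open>The fundamental theorem tolerates the finite set \<open>S\<close> because the
    coordinate curve is continuous.\<close>
  then have "((\<lambda>t. velocity A {a..b} \<sigma> t c) has_integral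
      (snd c \<circ> \<sigma>) b - (snd c \<circ> \<sigma>) s) {s..b}"
    using S s dom by (intro fundamental_theorem_of_calculus_strong deriv) auto
  then have "((\<lambda>t. \<kappa> * (l \<bullet> velocity A {a..b} \<sigma> t c)) has_integral
      \<kappa> * (l \<bullet> ((snd c \<circ> \<sigma>) b - (snd c \<circ> \<sigma>) s))) {s..b}"
    by (intro has_integral_mult_right has_integral_linear[OF _ bounded_linear_inner_right, unfolded o_def])
  then have "(g has_integral \<kappa> * (l \<bullet> ((snd c \<circ> \<sigma>) b - (snd c \<circ> \<sigma>) s))) {s..b}"
    by (rule has_integral_spike_finite[OF S, rotated]) (simp add: g_def)
  then have g_int: "(g has_integral \<kappa> * chart_norm c x0 (snd c (\<sigma> b) - snd c (\<sigma> s))) {s..b}"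
    using l(2) by simp
  have f_int': "f integrable_on {s..b}"
    using s by (intro integrable_subinterval_real[OF f_int]) auto
  have "g t \<le> f t" if t: "t \<in> {s..b}" for t
  proof (cases "t \<in> S")
    case False
    let ?w = "velocity A {a..b} \<sigma> t c"
    have tab: "t \<in> {a..b} - S" using t s False by auto
    have "\<kappa> * (l \<bullet> ?w) \<le> \<kappa> * chart_norm c x0 ?w"
      using l(1) \<open>0 \<le> \<kappa>\<close> mult_left_mono by blast
    also have "\<dots> \<le> chart_norm c (snd c (\<sigma> t)) ?w"
      using near t by blast
    also have "\<dots> = F (\<sigma> t) (velocity A {a..b} \<sigma> t)"
      using F_eq_chart_norm[OF c dom[OF t] tangent[OF tab]] by simp
    finally show ?thesis using False by (simp add: f_def g_def)
  qed (simp add: f_def g_def)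
  then have "\<kappa> * chart_norm c x0 (snd c (\<sigma> b) - snd c (\<sigma> s)) \<le> integral {s..b} f"
    using has_integral_le[OF g_int integrable_integral[OF f_int']] by blast
  \<comment> \<open>The part of the path before \<open>s\<close> contributes a nonnegative
    amount.\<close>
  also have "\<dots> \<le> integral {a..b} f"
    using s f_int f_int' f_nonneg by (intro integral_subset_le) auto
  also have "\<dots> = finsler_length A F a b \<sigma>"
    unfolding finsler_length_def by (rule integral_spike[OF negligible_finite[OF S]]) (simp add: f_def)
  finally show ?thesis .
qed

text \<open>Only the part of the path after its last visit outside the coordinate ball is estimated.\<close>

lemma finsler_length_ge_near:
  assumes "a < b" and path: "piecewise_C1_path X A a b \<sigma>"
    and c: "c \<in> A" and \<sigma>b: "\<sigma> b \<in> fst c"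
    and "0 < r" and ball: "cball (snd c (\<sigma> b)) r \<subseteq> snd c ` fst c"
    and "0 \<le> \<kappa>"
    and near: "\<And>x w. x \<in> cball (snd c (\<sigma> b)) r \<Longrightarrow>
      \<kappa> * chart_norm c (snd c (\<sigma> b)) w \<le> chart_norm c x w"
    and m: "\<And>w. m * norm w \<le> chart_norm c (snd c (\<sigma> b)) w"
    and close: "chart_norm c (snd c (\<sigma> b)) (snd c (\<sigma> b) - snd c (\<sigma> a)) \<le> m * r"
  shows "\<kappa> * chart_norm c (snd c (\<sigma> b)) (snd c (\<sigma> b) - snd c (\<sigma> a)) \<le> finsler_length A F a b \<sigma>"
proof -
  define x0 where "x0 = snd c (\<sigma> b)"
  note facts = ball near m close
  note facts = facts[folded x0_def]
  have x0: "x0 \<in> snd c ` fst c" using \<sigma>b by (simp add: x0_def)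
  have \<sigma>: "continuous_map (top_of_set {a..b}) X \<sigma>"
    using path by (simp add: piecewise_C1_path_def)
  \<comment> \<open>The open and the closed coordinate ball, pulled back to the manifold.
    \<open>K\<close> is closed there as a compact set in a Hausdorff space.\<close>
  define G where "G = {q \<in> fst c. snd c q \<in> ball x0 r}"
  define K where "K = {q \<in> fst c. snd c q \<in> cball x0 r}"
  define T where "T = {t \<in> {a..b}. \<sigma> t \<notin> G}"
  have GK: "G \<subseteq> K" by (auto simp: G_def K_def)
  have "K = chart_inv c ` cball x0 r"
  proof (intro equalityI subsetI)
    fix q assume "q \<in> K"
    then show "q \<in> chart_inv c ` cball x0 r"
      using chart_inv_chart[OF c, of q] by (force simp: K_def)
  next
    fix q assume "q \<in> chart_inv c ` cball x0 r"
    then obtain x where x: "x \<in> cball x0 r" "q = chart_inv c x" by blast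
    then have "x \<in> snd c ` fst c" using facts(1) by blast
    then show "q \<in> K"
      using x by (auto simp: K_def inv_into_into f_inv_into_f)
  qed
  moreover have "compactin (top_of_set (snd c ` fst c)) (cball x0 r)"
    using facts(1) by (simp add: compactin_subtopology)
  ultimately have "compactin X K"
    using image_compactin continuous_map_chart_inv[OF c] by metis
  then have "closedin X K"
    using Hausdorff compactin_imp_closedin by blast
  then have "closedin (top_of_set {a..b}) {t \<in> {a..b}. \<sigma> t \<in> K}"
    using closedin_continuous_map_preimage[OF \<sigma>] by simp
  then have closedK: "closed {t \<in> {a..b}. \<sigma> t \<in> K}"
    by (rule closedin_closed_trans) simp
  have "openin X G"
    using openin_chart_preimage[OF c open_ball] by (simp add: G_def)
  then have "openin (top_of_set {a..b}) {t \<in> {a..b}. \<sigma> t \<in> G}"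
    using openin_curve_preimage[OF \<sigma>] by blast
  moreover have "T = {a..b} - {t \<in> {a..b}. \<sigma> t \<in> G}" by (auto simp: T_def)
  ultimately have "closedin (top_of_set {a..b}) T"
    using closedin_diff[OF closedin_topspace] by (metis topspace_euclidean_subtopology)
  then have "compact T"
    using closedin_compact compact_Icc by blast
  show ?thesis
  proof (cases "T = {}")
    \<comment> \<open>A path that never leaves \<open>G\<close> is estimated from its start, with
      \<open>s = a\<close>.\<close>
    case True
    then have "\<sigma> t \<in> fst c" "snd c (\<sigma> t) \<in> cball x0 r" if "t \<in> {a..b}" for t
      using that by (auto simp: T_def G_def)
    then show ?thesis
      using \<open>a < b\<close> \<open>0 \<le> \<kappa>\<close> facts(2) finsler_length_ge[OF \<open>a < b\<close> path c x0, of a \<kappa>]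
      by (simp add: x0_def)
  next
    case False
    \<comment> \<open>The last time outside \<open>G\<close>, which exists by compactness of
      \<open>T\<close>.\<close>
    then obtain s where s: "s \<in> T" "\<And>t. t \<in> T \<Longrightarrow> t \<le> s"
      using compact_attains_sup[OF \<open>compact T\<close>] by blast
    have "\<sigma> b \<in> G" using \<sigma>b \<open>0 < r\<close> by (simp add: G_def x0_def)
    then have "s \<noteq> b" using s(1) by (auto simp: T_def)
    then have sb: "a \<le> s" "s < b" using s(1) by (auto simp: T_def)
    \<comment> \<open>After \<open>s\<close> the path stays in \<open>G\<close>, hence in
      \<open>K\<close>; since \<open>K\<close> is closed, this extends to the time \<open>s\<close>
      itself.\<close>
    have "{s<..<b} \<subseteq> {t \<in> {a..b}. \<sigma> t \<in> K}"
    proof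
      fix t assume t: "t \<in> {s<..<b}"
      then have "t \<notin> T" using s(2)[of t] by auto
      with t sb GK show "t \<in> {t \<in> {a..b}. \<sigma> t \<in> K}" by (auto simp: T_def)
    qed
    then have "closure {s<..<b} \<subseteq> {t \<in> {a..b}. \<sigma> t \<in> K}"
      using closedK closure_minimal by blast
    then have inK: "\<sigma> t \<in> K" if "t \<in> {s..b}" for t
      using sb that by auto
    then have "\<kappa> * chart_norm c x0 (x0 - snd c (\<sigma> s)) \<le> finsler_length A F a b \<sigma>"
      using sb \<open>0 \<le> \<kappa>\<close> facts(2) finsler_length_ge[OF \<open>a < b\<close> path c x0, of s \<kappa>]
      by (simp add: x0_def K_def)
    \<comment> \<open>At time \<open>s\<close> the path is in \<open>K\<close> but not in
      \<open>G\<close>, hence on the coordinate sphere. There the norm at \<open>x0\<close> of the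
      displacement is at least \<open>m * r\<close>, which by \<open>close\<close> is no less than
      that of the displacement from the starting point.\<close>
    moreover have "norm (x0 - snd c (\<sigma> s)) = r"
      using s(1) inK[of s] sb by (auto simp: T_def G_def K_def dist_norm)
    then have "chart_norm c x0 (x0 - snd c (\<sigma> a)) \<le> chart_norm c x0 (x0 - snd c (\<sigma> s))"
      using facts(3)[of "x0 - snd c (\<sigma> s)"] facts(4) by simp
    ultimately show ?thesis
      using \<open>0 \<le> \<kappa>\<close> mult_left_mono unfolding x0_def by (meson order_trans)
  qed
qed

section \<open>Upper bound by coordinate segments\<close>

text \<open>The coordinate segment, run through in unit time, is an admissible path with constant
  coordinate velocity \<open>x - y\<close>, so a bound \<open>B\<close> on its integrand bounds its
  length.\<close>

lemma finsler_dist_le_segment: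
  assumes c: "c \<in> A" and segment: "closed_segment y x \<subseteq> snd c ` fst c"
    and bound: "\<And>z. z \<in> closed_segment y x \<Longrightarrow> chart_norm c z (x - y) \<le> B"
  shows "finsler_dist X A F (chart_inv c y) (chart_inv c x) \<le> ereal B"
proof -
  define line where "line = (\<lambda>t::real. y + t *\<^sub>R (x - y))"
  define \<sigma> where "\<sigma> = chart_inv c \<circ> line"
  let ?I = "{0..1::real}"
  have line: "line t \<in> closed_segment y x" if "t \<in> ?I" for t
    using that by (auto simp: in_segment line_def algebra_simps)
  have range: "line t \<in> snd c ` fst c" if "t \<in> ?I" for t
    using line[OF that] segment by blast
  have \<sigma>c: "\<sigma> t \<in> fst c" and chart_\<sigma>: "snd c (\<sigma> t) = line t" if "t \<in> ?I" for t
    using range[OF that] by (auto simp: \<sigma>_def inv_into_into f_inv_into_f)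
  have line_cont: "continuous_on S line" for S
    unfolding line_def by (intro continuous_intros)
  have "continuous_map (top_of_set ?I) (top_of_set (snd c ` fst c)) line"
    using range line_cont by (auto simp: continuous_map_in_subtopology)
  then have \<sigma>: "continuous_map (top_of_set ?I) X \<sigma>"
    unfolding \<sigma>_def using continuous_map_chart_inv[OF c] by (rule continuous_map_compose)
  have der_line: "(line has_vector_derivative (x - y)) (at t within ?I)" for t
    unfolding line_def by (auto intro!: derivative_eq_intros)
  have der_c: "((snd c \<circ> \<sigma>) has_vector_derivative (x - y)) (at t within ?I)" if "t \<in> ?I" for t
    by (rule has_vector_derivative_transform_within[OF der_line zero_less_one that]) (simp add: chart_\<sigma>)
  have der: "((snd d \<circ> \<sigma>) has_vector_derivative transition_deriv c d (line t) (x - y)) (at t within ?I)"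
    if "t \<in> ?I" "d \<in> A" "\<sigma> t \<in> fst d" for t d
    using velocity_transition[OF \<sigma> c that(2,1) \<sigma>c that(3) der_c] that(1) chart_\<sigma>
    by simp
  have velocity: "velocity A ?I \<sigma> t = tvec c (\<sigma> t) (x - y)" if t: "t \<in> ?I" for t
  proof
    fix d
    have nontriv: "at t within ?I \<noteq> bot"
      using islimpt_IccI[of 0 1 t] t by (simp add: trivial_limit_within)
    show "velocity A ?I \<sigma> t d = tvec c (\<sigma> t) (x - y) d"
      using vector_derivative_within[OF nontriv der[OF t]] chart_\<sigma>[OF t]
      by (simp add: velocity_def tvec_def)
  qed
  have C1: "C1_curve_on X A ?I \<sigma>"
    unfolding C1_curve_on_def differentiable_curve_on_def
  proof (intro conjI ballI impI \<sigma>)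
    show "(snd d \<circ> \<sigma>) differentiable (at t within ?I)" if "d \<in> A" "t \<in> ?I" "\<sigma> t \<in> fst d" for d t
      using der[OF that(2,1,3)] by (auto simp: has_vector_derivative_def differentiable_def)
    fix d assume d: "d \<in> A"
    have "line t \<in> snd c ` (fst c \<inter> fst d)" if "t \<in> ?I" "\<sigma> t \<in> fst d" for t
      using \<sigma>c chart_\<sigma> that by (metis IntI imageI)
    then have "continuous_on {t \<in> ?I. \<sigma> t \<in> fst d} (\<lambda>t. transition_deriv c d (line t) (x - y))"
      by (intro continuous_on_compose2[OF continuous_on_transition_deriv[OF c d] line_cont]) auto
    then show "continuous_on {t \<in> ?I. \<sigma> t \<in> fst d} (\<lambda>t. velocity A ?I \<sigma> t d)"
      by (rule continuous_on_eq) (use velocity d chart_\<sigma> in \<open>auto simp: tvec_def\<close>)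
  qed
  have path: "piecewise_C1_path X A 0 1 \<sigma>"
    unfolding piecewise_C1_path_def
  \<comment> \<open>The goals below fix the witnesses: one \<open>C1\<close> piece, with
    \<open>n = 1\<close> and the partition map \<open>real\<close>.\<close>
  proof (intro conjI \<sigma> exI)
    show "real 0 = 0" "real 1 = 1" by simp_all
    show "\<forall>i<1. real i < real (Suc i) \<and> C1_curve_on X A {real i..real (Suc i)} \<sigma>"
      using C1 by simp
  qed
  have ends: "\<sigma> 0 = chart_inv c y" "\<sigma> 1 = chart_inv c x"
    by (simp_all add: \<sigma>_def line_def)
  have "finsler_dist X A F (chart_inv c y) (chart_inv c x) \<le> ereal (finsler_length A F 0 1 \<sigma>)"
    unfolding finsler_dist_def
    by (rule Inf_lower) (use path ends zero_less_one in blast)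
  also have "finsler_length A F 0 1 \<sigma> \<le> integral ?I (\<lambda>t. B)"
    unfolding finsler_length_def
  proof (rule integral_le)
    show "(\<lambda>t. F (\<sigma> t) (velocity A ?I \<sigma> t)) integrable_on ?I"
      using piecewise_C1_path_regular(1)[OF _ path] by simp
    show "F (\<sigma> t) (velocity A ?I \<sigma> t) \<le> B" if "t \<in> ?I" for t
      using bound[OF line[OF that]] velocity[OF that] by (simp add: chart_norm_def \<sigma>_def)
  qed (rule integrable_const_ivl)
  also have "integral ?I (\<lambda>t. B) = B" by simp
  finally show ?thesis by simp
qed

section \<open>The limit of the distance quotient\<close>

lemma finsler_dist_quotient_tendsto:
  assumes "0 < a" and \<gamma>: "differentiable_curve_on X A {-a<..<a} \<gamma>"
  shows "((\<lambda>t. finsler_dist X A F (\<gamma> t) (\<gamma> 0) / ereal \<bar>t\<bar>) \<longlongrightarrow>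
    ereal (F (\<gamma> 0) (velocity A {-a<..<a} \<gamma> 0))) (at 0)"
proof -
  let ?J = "{-a<..<a}"
  define p where "p = \<gamma> 0"
  define v where "v = velocity A ?J \<gamma> 0"
  have J: "0 \<in> ?J" using \<open>0 < a\<close> by simp
  have \<gamma>_cont: "continuous_map (top_of_set ?J) X \<gamma>"
    using \<gamma> by (simp add: differentiable_curve_on_def)
  then have "p \<in> topspace X"
    using J continuous_map_image_subset_topspace[OF \<gamma>_cont] by (auto simp: p_def)
  then obtain c where c: "c \<in> A" and p: "p \<in> fst c" using chart_cover by blast
  define x0 where "x0 = snd c p"
  have x0: "x0 \<in> snd c ` fst c" using p by (simp add: x0_def)
  define u where "u = snd c \<circ> \<gamma>"
  have u0: "u 0 = x0" by (simp add: u_def x0_def p_def)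
  let ?N = "chart_norm c x0"
  note facts = chart_norm_facts[OF c x0]
  have "0 islimpt ?J" using J by (intro interior_limit_point) (simp add: interior_open)
  then have "v \<in> tangent_space A p"
    unfolding v_def p_def by (rule velocity_in_tangent_space[OF \<gamma> J])
  then have Fv: "F p v = ?N (v c)"
    using F_eq_chart_norm[OF c p] by (simp add: x0_def)
  have der: "(u has_vector_derivative v c) (at 0)"
    using chart_curve_has_vector_derivative[OF \<gamma> c J] p J at_within_open[OF J]
    by (simp add: u_def v_def p_def)
  have quotient: "((\<lambda>t. (1 / t) *\<^sub>R (u t - x0)) \<longlongrightarrow> v c) (at 0)"
  proof -
    have lim: "((\<lambda>t. norm (u t - x0 - t *\<^sub>R v c) / norm t) \<longlongrightarrow> 0) (at 0)"
      using der unfolding has_vector_derivative_def has_derivative_at by (simp add: u0)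
    have eq: "norm (u t - x0 - t *\<^sub>R v c) / norm t = norm ((1 / t) *\<^sub>R (u t - x0) - v c)"
      if "t \<noteq> 0" for t
    proof -
      have "(1 / t) *\<^sub>R (u t - x0) - v c = (1 / t) *\<^sub>R (u t - x0 - t *\<^sub>R v c)"
        using that by (simp add: scaleR_diff_right)
      then show ?thesis by simp
    qed
    have "((\<lambda>t. norm ((1 / t) *\<^sub>R (u t - x0) - v c)) \<longlongrightarrow> 0) (at 0)"
      by (rule LIM_equal[THEN iffD1, OF _ lim]) (use eq in blast)
    then show ?thesis
      by (rule LIM_zero_cancel[OF tendsto_norm_zero_cancel])
  qed
  \<comment> \<open>The comparison quantity: the distance quotient for the constant norm
    \<open>?N\<close> in the chart.\<close>
  define R where "R t = ?N ((1 / t) *\<^sub>R (u t - x0))" for t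
  have N_cont: "isCont ?N w" for w
    using continuous_on_chart_norm_at[OF c x0] by (simp add: continuous_on_eq_continuous_at)
  have R: "(R \<longlongrightarrow> F p v) (at 0)"
    unfolding R_def Fv by (rule isCont_tendsto_compose[OF N_cont quotient])
  \<comment> \<open>Absolute homogeneity produces \<open>\<bar>t\<bar>\<close> for either sign of
    \<open>t\<close> and allows reversing the difference.\<close>
  have R_eq: "R t = ?N (x0 - u t) / \<bar>t\<bar>" for t
    unfolding R_def facts(2) chart_norm_minus[OF c x0, of x0] by simp
  have u_lim: "(u \<longlongrightarrow> x0) (at 0)"
    using has_vector_derivative_continuous[OF der] by (simp add: isCont_def u0)
  have N_lim: "((\<lambda>t. ?N (x0 - u t)) \<longlongrightarrow> 0) (at 0)"
  proof -
    have "((\<lambda>t. x0 - u t) \<longlongrightarrow> 0) (at 0)"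
      using tendsto_diff[OF tendsto_const u_lim, of x0] by simp
    from isCont_tendsto_compose[OF N_cont this] show ?thesis
      using facts(2)[of 0 0] by simp
  qed
  have dom: "\<forall>\<^sub>F t in at 0. \<gamma> t \<in> fst c"
  proof -
    have "open {t \<in> ?J. \<gamma> t \<in> fst c}"
      using openin_open_trans[OF openin_curve_preimage[OF \<gamma>_cont openin_chart_domain[OF c]]]
      by simp
    then have "\<forall>\<^sub>F t in at 0. t \<in> {t \<in> ?J. \<gamma> t \<in> fst c}"
      using J p by (intro eventually_at_in_open') (auto simp: p_def)
    then show ?thesis by eventually_elim simp
  qed
  have nonzero: "\<forall>\<^sub>F t in at 0. t \<noteq> (0::real)"
    by (simp add: eventually_at_filter)
  obtain m where m: "0 < m" "\<And>w. m * norm w \<le> ?N w"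
    using chart_norm_lower_bound[OF c x0] by blast
  have main: "\<forall>\<^sub>F t in at 0. ereal ((1 - \<delta>) * R t) \<le> finsler_dist X A F (\<gamma> t) p / ereal \<bar>t\<bar> \<and>
      finsler_dist X A F (\<gamma> t) p / ereal \<bar>t\<bar> \<le> ereal ((1 + \<delta>) * R t)"
    if \<delta>: "0 < \<delta>" "\<delta> < 1" for \<delta>
  proof -
    obtain r where r: "0 < r" "cball x0 r \<subseteq> snd c ` fst c"
      and near: "\<And>x w. x \<in> cball x0 r \<Longrightarrow> \<bar>chart_norm c x w - ?N w\<bar> \<le> \<delta> * ?N w"
      using norm_family_nearly_constant[OF open_chart_range[OF c] x0 \<delta>(1)
          continuous_on_chart_norm[OF c] chart_norm_scale[OF c] facts(4)] by blast
    \<comment> \<open>Two smallness conditions: this one keeps the segment from \<open>u t\<close>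
      to \<open>x0\<close> inside the ball, the next one ensures that leaving the ball cannot push a
      path below the bound.\<close>
    have "\<forall>\<^sub>F t in at 0. dist (u t) x0 < r"
      using tendstoD[OF u_lim r(1)] .
    moreover have "\<forall>\<^sub>F t in at 0. ?N (x0 - u t) < m * r"
      using order_tendstoD(2)[OF N_lim] m(1) r(1) by simp
    ultimately show ?thesis
      using dom nonzero
    proof eventually_elim
      case (elim t)
      have chart: "snd c (\<gamma> t) = u t" by (simp add: u_def)
      have inv: "chart_inv c (u t) = \<gamma> t" "chart_inv c x0 = p"
        using elim(3) p c by (simp_all add: u_def x0_def)
      \<comment> \<open>Every admissible path obeys the bound, wherever it runs, and so does the
        infimum.\<close>
      have lower: "ereal ((1 - \<delta>) * ?N (x0 - u t)) \<le> finsler_dist X A F (\<gamma> t) p"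
        unfolding finsler_dist_def
      proof (rule Inf_greatest, clarify)
        fix a b \<sigma> assume \<sigma>: "a < b" "piecewise_C1_path X A a b \<sigma>" "\<sigma> a = \<gamma> t" "p = \<sigma> b"
        have "(1 - \<delta>) * ?N w \<le> chart_norm c x w" if "x \<in> cball x0 r" for x w
          using near[OF that, of w] by (simp add: algebra_simps)
        then show "ereal ((1 - \<delta>) * ?N (x0 - u t)) \<le> ereal (finsler_length A F a b \<sigma>)"
          using finsler_length_ge_near[OF \<sigma>(1,2) c, of r "1 - \<delta>" m] p elim r m \<delta>
          by (simp add: \<sigma>(3) chart flip: \<sigma>(4) x0_def)
      qed
      have "closed_segment (u t) x0 \<subseteq> cball x0 r"
        using elim(1) r(1) by (intro closed_segment_subset) (auto simp: dist_commute)
      moreover have "chart_norm c z w \<le> (1 + \<delta>) * ?N w" if "z \<in> cball x0 r" for z w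
        using near[OF that, of w] by (simp add: algebra_simps)
      ultimately have upper: "finsler_dist X A F (\<gamma> t) p \<le> ereal ((1 + \<delta>) * ?N (x0 - u t))"
        using finsler_dist_le_segment[OF c, of "u t" x0] r(2) unfolding inv by blast
      have t: "0 < ereal \<bar>t\<bar>" using elim(4) by simp
      have "ereal (s * R t) = ereal (s * ?N (x0 - u t)) / ereal \<bar>t\<bar>" for s
        using elim(4) by (simp add: R_eq)
      then show ?case
        using ereal_divide_right_mono[OF lower t] ereal_divide_right_mono[OF upper t] by simp
    qed
  qed
  have "((\<lambda>t. finsler_dist X A F (\<gamma> t) p / ereal \<bar>t\<bar>) \<longlongrightarrow> ereal (F p v)) (at 0)"
    by (rule tendsto_ereal_relative_error[OF R]; drule (1) main; elim eventually_mono) blast+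
  then show ?thesis by (simp add: p_def v_def)
qed

end

theorem theorem3p7:
  fixes k :: enat
    and X :: "'a topology"
    and A :: "('a, 'e::euclidean_space) chart set"
    and F :: "'a \<Rightarrow> ('a, 'e) tangent_vector \<Rightarrow> real"
    and \<gamma> :: "real \<Rightarrow> 'a" and a :: real
    and p :: 'a and v :: "('a, 'e) tangent_vector"
  assumes "differentiable_manifold k X A"
    and "finsler_metric X A F"
    and "0 < a"
    and "differentiable_curve_on X A {-a<..<a} \<gamma>"
    and "\<gamma> 0 = p"
    and "velocity A {-a<..<a} \<gamma> 0 = v"
  shows "((\<lambda>t. finsler_dist X A F (\<gamma> t) p / ereal \<bar>t\<bar>) \<longlongrightarrow> ereal (F p v)) (at 0)"
proof -
  interpret finsler_manifold k X A F
    using assms(1,2) by unfold_locales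
  show ?thesis
    using finsler_dist_quotient_tendsto[OF assms(3,4)] assms(5,6) by simp
qed

end
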